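(* The following assertions hold. (1) Let $T=(T(t))_{t\ge 0}$ be a semigroup of bounded linear operators on a Banach space $X$ (no continuity in $t$ is assumed). If $$\sup_{t\ge 0}\|T(t)-I\|<1,$$ then $T(t)=I$ for all $t\ge 0$. (2) Let $C=(C(t))_{t\in\mathbb{R}}$ be a strongly continuous cosine family on a Banach space $X$. If $$\sup_{t\ge 0}\|C(t)-I\|=r<2,$$ then $C(t)=I$ for all $t\in\mathbb{R}$.
   Context: A semigroup $(T(t))_{t\ge 0}$ of bounded linear operators on a Banach space $X$ is a family with $T(0)=I$ and $T(t+s)=T(t)T(s)$ for all $t,s\ge 0$. A family $C=(C(t))_{t\in\mathbb{R}}$ of bounded linear operators on $X$ is called a cosine family if $C(0)=I$ and $2C(t)C(s)=C(t+s)+C(t-s)$ for all $t,s\in\mathbb{R}$. It is strongly continuous if $\lim_{h\to 0}C(t+h)x=C(t)x$ for all $x\in X$ and all $t\in\mathbb{R}$. $I$ is the identity operator and $\|\cdot\|$ on operators is the operator norm. *)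

theory Defs
  imports "HOL-Analysis.Analysis"
begin

(* A semigroup indexed by [0,infinity) is encoded as a function on all reals
   whose values at negative arguments are irrelevant. *)
definition operator_semigroup :: "(real \<Rightarrow> 'a::banach \<Rightarrow>\<^sub>L 'a) \<Rightarrow> bool" where
  "operator_semigroup T \<longleftrightarrow>
     T 0 = id_blinfun \<and> (\<forall>t\<ge>0. \<forall>s\<ge>0. T (t + s) = T t o\<^sub>L T s)"

definition cosine_family :: "(real \<Rightarrow> 'a::banach \<Rightarrow>\<^sub>L 'a) \<Rightarrow> bool" where
  "cosine_family C \<longleftrightarrow>
     C 0 = id_blinfun \<and> (\<forall>t s. 2 *\<^sub>R (C t o\<^sub>L C s) = C (t + s) + C (t - s))"

definition strongly_continuous :: "(real \<Rightarrow> 'a::banach \<Rightarrow>\<^sub>L 'a) \<Rightarrow> bool" where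
  "strongly_continuous C \<longleftrightarrow>
     (\<forall>x t. ((\<lambda>h. blinfun_apply (C (t + h)) x) \<longlongrightarrow> blinfun_apply (C t) x) (at 0))"

(* Taken in the extended reals: on type real, the supremum of an unbounded set
   is an unspecified number, so a bound on it would not imply boundedness. *)
definition sup_dist_id :: "(real \<Rightarrow> 'a::banach \<Rightarrow>\<^sub>L 'a) \<Rightarrow> ereal" where
  "sup_dist_id F = (SUP t\<in>{0..}. ereal (norm (F t - id_blinfun)))"

end

theory Submission
  imports Defs
begin

text \<open>
  For a semigroup, \<open>2 (T(t) - I) = (T(2t) - I) - (T(t) - I)\<^sup>2\<close>. The supremum \<open>r\<close> of the norms
  therefore satisfies \<open>2 r \<le> r + r\<^sup>2\<close>, which together with \<open>r < 1\<close> forces \<open>r = 0\<close>.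

  For a cosine family put \<open>K(t) = (I - C(t)) / 2\<close>; in the scalar case \<open>C(t) = cos (a t)\<close> this is
  \<open>sin\<^sup>2 (a t / 2)\<close>. Then \<open>\<parallel>K(t)\<parallel> \<le> q < 1\<close> and \<open>K(2t) = 4 K(t) (I - K(t))\<close>. The same estimate as for
  semigroups now succeeds only for \<open>q < 3/4\<close>, and the scalar solutions of the doubling
  formula show why: for given \<open>K(2t)\<close> it has two roots, \<open>K(t)\<close> and \<open>I - K(t)\<close>, and at
  \<open>a t = 2 \<pi> / 3\<close> it is the large root \<open>3/4\<close> that recurs at \<open>t, 2t, 4t, \<dots>\<close>. The proof shows
  that \<open>K(t)\<close> is always the small root.

  Since \<open>\<parallel>K(2t)\<parallel> \<le> q < 1\<close>, the contraction principle yields a small root \<open>Y(t)\<close> of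
  \<open>4 Y (I - Y) = K(2t)\<close>, of norm below \<open>1/2\<close> (\<open>small_quadratic_root\<close>). It commutes with everything
  in sight, so \<open>(K(t) - Y(t)) (I - K(t) - Y(t)) = 0\<close>. Call a vector \<open>x\<close> principal at \<open>t\<close> if
  \<open>K(t) x = Y(t) x\<close>. On such vectors halving the time at least halves the size of \<open>K\<close>, because
  \<open>\<parallel>Y(t) x\<parallel> \<le> \<parallel>K(2t) x\<parallel> / 2\<close>. Hence, once all vectors are principal at all times,
  \<open>\<parallel>K(t)\<parallel> = \<parallel>K(2\<^sup>n t / 2\<^sup>n)\<parallel> \<le> q / 2\<^sup>n\<close> for every \<open>n\<close>, and \<open>K = 0\<close>.

  Three ideas give principality. (a) If \<open>x\<close> is principal at sufficiently many consecutive
  dyadic fractions \<open>t/2, \<dots>, t/2\<^sup>n\<close>, then \<open>Y(t/2\<^bsup>n+1\<^esup>) x\<close> is tiny. On the other branch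
  \<open>K = I - Y\<close> would then be almost the identity, which \<open>\<parallel>K\<parallel> \<le> q < 1\<close> excludes; so \<open>x\<close> is
  principal at all smaller dyadic fractions as well (\<open>principal_all_smaller\<close>). (b) Every vector
  is a limit of vectors that are principal at all sufficiently small dyadic fractions of a given
  time: the product of the operators \<open>I - K(t/2\<^sup>i) - Y(t/2\<^sup>i)\<close>, \<open>i = 1, \<dots>, n\<close>, maps into the
  vectors principal at \<open>t/2, \<dots>, t/2\<^sup>n\<close>, and tends strongly to \<open>I\<close> as \<open>t\<close> tends to \<open>0\<close>. This
  is where strong continuity enters (\<open>F_tendsto\<close>).
  (c) On the subspace of vectors principal at all \<open>t/2\<^sup>k\<close>, \<open>K(t/2\<^sup>k)\<close> tends
  to \<open>0\<close> uniformly, not just strongly. So \<open>K\<close> and \<open>Y\<close> change little in norm along the multiples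
  of \<open>t/2\<^sup>k\<close> and, the two roots being a definite distance apart, \<open>K\<close> cannot jump from
  one to the other: principality propagates from \<open>0\<close> to all these multiples
  (\<open>principal_if_small_steps\<close>, \<open>principal_at_multiple\<close>).
\<close>

section \<open>Semigroups\<close>

lemma norm_le_if_sup_dist_id_le:
  assumes "sup_dist_id F \<le> ereal r" "t \<ge> 0"
  shows "norm (F t - id_blinfun) \<le> r"
proof -
  have "ereal (norm (F t - id_blinfun)) \<le> sup_dist_id F"
    unfolding sup_dist_id_def using assms(2) by (intro SUP_upper) auto
  with assms(1) show ?thesis
    by (metis ereal_less_eq(3) order_trans)
qed

lemma semigroup_near_identity_trivial:
  fixes T :: "real \<Rightarrow> 'a::banach \<Rightarrow>\<^sub>L 'a"
  assumes T: "operator_semigroup T" and near: "sup_dist_id T < 1" and "t \<ge> 0"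
  shows "T t = id_blinfun"
proof -
  define d where "d t = norm (T t - id_blinfun)" for t
  obtain c where c: "sup_dist_id T \<le> ereal c" "c < 1"
    using ereal_dense2[OF near] by (metis ereal_less(3) less_imp_le less_ereal.simps(1) one_ereal_def)
  have dc: "d t \<le> c" if "t \<ge> 0" for t
    using norm_le_if_sup_dist_id_le[OF c(1) that] by (simp add: d_def)
  define r where "r = (SUP t\<in>{0..}. d t)"
  have bdd: "bdd_above (d ` {0..})"
    using dc by (intro bdd_aboveI2[where M = c]) auto
  have dr: "d t \<le> r" if "t \<ge> 0" for t
    unfolding r_def using bdd that by (intro cSUP_upper) auto
  have rc: "r \<le> c"
    unfolding r_def using dc by (intro cSUP_least) auto
  have "0 \<le> d 0"
    by (simp add: d_def)
  then have r0: "0 \<le> r"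
    using dr[of 0] by linarith
  have "d t \<le> (r + r * r) / 2" if t: "t \<ge> 0" for t
  proof -
    have "T (t + t) = T t o\<^sub>L T t"
      using T t unfolding operator_semigroup_def by blast
    then have "2 *\<^sub>R (T t - id_blinfun)
        = (T (t + t) - id_blinfun) - ((T t - id_blinfun) o\<^sub>L (T t - id_blinfun))"
      by (intro blinfun_eqI)
         (simp add: blinfun.diff_left blinfun.diff_right blinfun.add_left scaleR_2)
    then have "2 * d t \<le> d (t + t) + norm ((T t - id_blinfun) o\<^sub>L (T t - id_blinfun))"
      unfolding d_def by (metis norm_scaleR abs_numeral norm_triangle_ineq4)
    also have "norm ((T t - id_blinfun) o\<^sub>L (T t - id_blinfun)) \<le> d t * d t"
      unfolding d_def by (rule norm_blinfun_compose)
    also have "d t * d t \<le> r * r"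
      using dr[OF t] r0 by (intro mult_mono) (auto simp: d_def)
    finally show ?thesis
      using dr[of "t + t"] t by simp
  qed
  then have "r \<le> (r + r * r) / 2"
    unfolding r_def by (intro cSUP_least) (auto simp flip: r_def)
  then have "r * (1 - r) \<le> 0"
    by (simp add: algebra_simps)
  then have "r \<le> 0"
    using rc c(2) r0 by (smt (verit) mult_pos_pos)
  with dr[OF \<open>t \<ge> 0\<close>] have "d t \<le> 0"
    by (rule order_trans)
  then show ?thesis
    by (simp add: d_def)
qed

section \<open>Square roots of operators close to the identity\<close>

text \<open>
  The bound \<open>\<rho> = (1 - sqrt (1 - q)) / 2\<close> is the smaller root of \<open>\<rho> = q/4 + \<rho>\<^sup>2\<close>. Hence
  \<open>Y \<mapsto> A/4 + Y\<^sup>2\<close> maps the ball of radius \<open>\<rho>\<close> into itself and contracts it by the factor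
  \<open>2 \<rho> < 1\<close>. The fixed point is sought within the bicommutant of \<open>A\<close>, a closed set that the map
  preserves, so that it inherits the commutation properties of \<open>A\<close>.
\<close>

lemma small_quadratic_root:
  fixes A :: "'a::banach \<Rightarrow>\<^sub>L 'a"
  assumes A: "norm A \<le> q" and q: "q < 1"
  obtains Y where "norm Y \<le> (1 - sqrt (1 - q)) / 2" "Y = (1/4) *\<^sub>R A + (Y o\<^sub>L Y)"
    "\<And>B. A o\<^sub>L B = B o\<^sub>L A \<Longrightarrow> Y o\<^sub>L B = B o\<^sub>L Y"
proof -
  have q0: "0 \<le> q" using A norm_ge_zero order_trans by blast
  define \<rho> where "\<rho> = (1 - sqrt (1 - q)) / 2"
  have \<rho>: "0 \<le> \<rho>" "2 * \<rho> < 1" "q / 4 + \<rho> * \<rho> = \<rho>"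
  proof -
    have s: "sqrt (1 - q) * sqrt (1 - q) = 1 - q" using q by simp
    show "0 \<le> \<rho>" using q0 by (simp add: \<rho>_def)
    show "2 * \<rho> < 1" using q by (simp add: \<rho>_def)
    show "q / 4 + \<rho> * \<rho> = \<rho>" using s unfolding \<rho>_def by (simp add: field_simps)
  qed
  define S where "S = cball 0 \<rho> \<inter> (\<Inter>B\<in>{B. A o\<^sub>L B = B o\<^sub>L A}. {Y. Y o\<^sub>L B = B o\<^sub>L Y})"
  have S: "Y \<in> S \<longleftrightarrow> norm Y \<le> \<rho> \<and> (\<forall>B. A o\<^sub>L B = B o\<^sub>L A \<longrightarrow> Y o\<^sub>L B = B o\<^sub>L Y)" for Y
    by (auto simp: S_def)
  have "closed S"
    unfolding S_def by (intro closed_Int closed_INT ballI closed_Collect_eq continuous_intros closed_cball)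
  then have "complete S" by (simp add: complete_eq_closed)
  moreover have "S \<noteq> {}"
  proof -
    have "0 \<in> S" using \<rho>(1) unfolding S by auto
    then show ?thesis by blast
  qed
  moreover define \<Phi> where "\<Phi> Y = (1/4) *\<^sub>R A + (Y o\<^sub>L Y)" for Y
  have "\<Phi> ` S \<subseteq> S"
  proof clarify
    fix Y assume Y: "Y \<in> S"
    have "norm (\<Phi> Y) \<le> norm ((1/4) *\<^sub>R A) + norm (Y o\<^sub>L Y)"
      unfolding \<Phi>_def by (rule norm_triangle_ineq)
    also have "norm ((1/4) *\<^sub>R A) \<le> q / 4" using A by simp
    also have "norm (Y o\<^sub>L Y) \<le> \<rho> * \<rho>"
      using Y unfolding S by (meson norm_blinfun_compose mult_mono norm_ge_zero \<rho>(1) order_trans)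
    finally have "norm (\<Phi> Y) \<le> \<rho>" using \<rho>(3) by simp
    moreover have "\<Phi> Y o\<^sub>L B = B o\<^sub>L \<Phi> Y" if B: "A o\<^sub>L B = B o\<^sub>L A" for B
    proof (rule blinfun_eqI)
      fix x
      have "A (B x) = B (A x)" "Y (B x) = B (Y x)" for x
        using B Y unfolding S by (metis blinfun_apply_blinfun_compose)+
      then show "(\<Phi> Y o\<^sub>L B) x = (B o\<^sub>L \<Phi> Y) x"
        by (simp add: \<Phi>_def blinfun.add_left blinfun.add_right blinfun.scaleR_left blinfun.scaleR_right)
    qed
    ultimately show "\<Phi> Y \<in> S" unfolding S by blast
  qed
  moreover have "dist (\<Phi> Y) (\<Phi> Y') \<le> (2 * \<rho>) * dist Y Y'" if "Y \<in> S" "Y' \<in> S" for Y Y'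
  proof -
    have "\<Phi> Y - \<Phi> Y' = (Y o\<^sub>L (Y - Y')) + ((Y - Y') o\<^sub>L Y')"
      by (intro blinfun_eqI) (simp add: \<Phi>_def blinfun.add_left blinfun.diff_left blinfun.diff_right)
    then have "dist (\<Phi> Y) (\<Phi> Y') \<le> norm Y * norm (Y - Y') + norm (Y - Y') * norm Y'"
      unfolding dist_norm by (metis norm_blinfun_compose norm_triangle_mono)
    also have "\<dots> \<le> \<rho> * norm (Y - Y') + norm (Y - Y') * \<rho>"
      using that \<rho>(1) unfolding S by (intro add_mono mult_mono) auto
    finally show ?thesis by (simp add: dist_norm algebra_simps)
  qed
  ultimately have "\<exists>!Y\<in>S. \<Phi> Y = Y"
    using \<rho>(1,2) by (intro Banach_fix) auto
  then obtain Y where "Y \<in> S" "\<Phi> Y = Y" by blast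
  then show ?thesis
    using that[of Y] unfolding S \<Phi>_def \<rho>_def by metis
qed

section \<open>First and second differences\<close>

text \<open>
  This is a discrete form of Landau's inequality between a function and its first two
  derivatives: if consecutive increments differ by at most \<open>\<eta>\<close>, then a large increment
  persists over \<open>N\<close> steps and contradicts boundedness.
\<close>

lemma first_difference_from_second:
  fixes a :: "nat \<Rightarrow> 'a::real_normed_vector"
  assumes second: "\<And>m. norm (a (m + 2) - 2 *\<^sub>R a (m + 1) + a m) \<le> \<eta>"
    and bound: "\<And>m. norm (a m) \<le> b"
  shows "real N * norm (a (m + 1) - a m) \<le> 2 * b + real N ^ 2 * \<eta>"
proof -
  define d where "d m = a (m + 1) - a m" for m
  have \<eta>: "0 \<le> \<eta>" using second[of 0] norm_ge_zero order_trans by blast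
  have dd: "norm (d (m + i) - d m) \<le> real i * \<eta>" for i
  proof (induction i)
    case (Suc i)
    have "d (m + Suc i) - d m = (a (m + i + 2) - 2 *\<^sub>R a (m + i + 1) + a (m + i)) + (d (m + i) - d m)"
      by (simp add: d_def scaleR_2)
    then have "norm (d (m + Suc i) - d m) \<le> \<eta> + real i * \<eta>"
      using norm_triangle_mono[OF second[of "m + i"] Suc.IH] by (simp only: add.assoc)
    then show ?case by (simp add: algebra_simps)
  qed simp
  have "a (m + N) - a m = (\<Sum>i<N. d (m + i))"
    using sum_lessThan_telescope[of "\<lambda>i. a (m + i)" N] by (simp add: d_def)
  also have "\<dots> = (\<Sum>i<N. d (m + i) - d m) + real N *\<^sub>R d m"
    by (simp add: sum_subtractf sum_constant_scaleR)
  finally have "real N *\<^sub>R d m = (a (m + N) - a m) - (\<Sum>i<N. d (m + i) - d m)"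
    by simp
  then have "real N * norm (d m) = norm ((a (m + N) - a m) - (\<Sum>i<N. d (m + i) - d m))"
    by (metis norm_scaleR abs_of_nat)
  also have "\<dots> \<le> norm (a (m + N) - a m) + norm (\<Sum>i<N. d (m + i) - d m)"
    by (rule norm_triangle_ineq4)
  also have "norm (a (m + N) - a m) \<le> b + b"
    using bound by (meson norm_triangle_ineq4 add_mono order_trans)
  also have "norm (\<Sum>i<N. d (m + i) - d m) \<le> (\<Sum>i<N. real N * \<eta>)"
    using \<eta> by (intro order_trans[OF norm_sum sum_mono] order_trans[OF dd] mult_right_mono) auto
  finally show ?thesis by (simp add: d_def power2_eq_square)
qed

section \<open>Deviation from the identity and its principal square root\<close>

text \<open>
  The bound is written as \<open>2 * q\<close> so that \<open>q\<close> itself bounds the operators \<open>K t\<close>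
  below, the analogues of \<open>sin\<^sup>2 (a t / 2)\<close>.
\<close>

locale cosine_near_identity =
  fixes C :: "real \<Rightarrow> 'a::banach \<Rightarrow>\<^sub>L 'a" and q :: real
  assumes cosine: "cosine_family C"
    and continuous: "strongly_continuous C"
    and near: "\<And>t. norm (C t - id_blinfun) \<le> 2 * q"
    and q_less_1: "q < 1"
begin

definition K :: "real \<Rightarrow> 'a \<Rightarrow>\<^sub>L 'a" where
  "K t = (1/2) *\<^sub>R (id_blinfun - C t)"

lemma C_0: "C 0 = id_blinfun"
  using cosine by (simp add: cosine_family_def)

lemma C_mult: "2 *\<^sub>R C t (C s x) = C (t + s) x + C (t - s) x"
proof -
  have "2 *\<^sub>R (C t o\<^sub>L C s) = C (t + s) + C (t - s)"
    using cosine by (simp add: cosine_family_def)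
  then have "(2 *\<^sub>R (C t o\<^sub>L C s)) x = (C (t + s) + C (t - s)) x" by simp
  then show ?thesis by (simp add: blinfun.scaleR_left blinfun.add_left)
qed

lemma C_even: "C (- t) x = C t x"
  using C_mult[of 0 t x] by (simp add: C_0 scaleR_2)

lemma C_commute: "C t (C s x) = C s (C t x)"
proof -
  have "2 *\<^sub>R C t (C s x) = 2 *\<^sub>R C s (C t x)"
    using C_mult[of t s x] C_mult[of s t x] C_even[of "t - s" x] by (simp add: add.commute)
  then show ?thesis by simp
qed

lemma q_nonneg: "0 \<le> q"
  using near[of 0] by (simp add: C_0)

lemma K_apply: "K t x = (1/2) *\<^sub>R (x - C t x)"
  by (simp add: K_def blinfun.scaleR_left blinfun.diff_left)

lemma C_apply: "C t x = x - 2 *\<^sub>R K t x"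
  by (simp add: K_apply)

lemma norm_K: "norm (K t) \<le> q"
  using near[of t] by (simp add: K_def norm_minus_commute)

lemma norm_K_apply: "norm (K t x) \<le> q * norm x"
  using norm_blinfun[of "K t" x] norm_K[of t] by (meson mult_right_mono norm_ge_zero order_trans)

lemma K_0: "K 0 x = 0"
  by (simp add: K_apply C_0)

lemma K_double: "K (2 * t) x = 4 *\<^sub>R (K t x - K t (K t x))"
proof -
  have "C (2 * t) x = 2 *\<^sub>R C t (C t x) - x"
    using C_mult[of t t x] by (simp add: C_0)
  then show ?thesis
    by (simp add: K_apply blinfun.diff_right blinfun.scaleR_right scaleR_diff_right scaleR_2
        flip: scaleR_left_distrib)
qed

lemma K_commute: "K t (K s x) = K s (K t x)"
  by (simp add: K_apply blinfun.diff_right blinfun.scaleR_right C_commute algebra_simps)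

lemma K_tendsto_0: "((\<lambda>h. K h x) \<longlongrightarrow> 0) (at 0)"
proof -
  have "((\<lambda>h. C h x) \<longlongrightarrow> C 0 x) (at 0)"
    using continuous[unfolded strongly_continuous_def, rule_format, of 0 x] by simp
  then have "((\<lambda>h. (1/2) *\<^sub>R (x - C h x)) \<longlongrightarrow> (1/2) *\<^sub>R (x - C 0 x)) (at 0)"
    by (intro tendsto_scaleR tendsto_diff tendsto_const)
  then show ?thesis by (simp add: K_apply C_0)
qed

definition \<rho> :: real where "\<rho> = (1 - sqrt (1 - q)) / 2"

lemma \<rho>_less: "2 * \<rho> < 1"
  using q_less_1 by (simp add: \<rho>_def)

text \<open>
  The operator analogue of \<open>sin\<^sup>2 (\<theta> / 2)\<close>, where \<open>\<theta>\<close> is the distance of \<open>a t\<close> to the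
  nearest multiple of \<open>\<pi>\<close>.
\<close>

definition Y :: "real \<Rightarrow> 'a \<Rightarrow>\<^sub>L 'a" where
  "Y t = (SOME Y. norm Y \<le> \<rho> \<and> Y = (1/4) *\<^sub>R K (2 * t) + (Y o\<^sub>L Y) \<and>
            (\<forall>B. K (2 * t) o\<^sub>L B = B o\<^sub>L K (2 * t) \<longrightarrow> Y o\<^sub>L B = B o\<^sub>L Y))"

lemma Y: "norm (Y t) \<le> \<rho>" "Y t = (1/4) *\<^sub>R K (2 * t) + (Y t o\<^sub>L Y t)"
  "K (2 * t) o\<^sub>L B = B o\<^sub>L K (2 * t) \<Longrightarrow> Y t o\<^sub>L B = B o\<^sub>L Y t"
proof -
  have "\<exists>Y. norm Y \<le> \<rho> \<and> Y = (1/4) *\<^sub>R K (2 * t) + (Y o\<^sub>L Y) \<and>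
            (\<forall>B. K (2 * t) o\<^sub>L B = B o\<^sub>L K (2 * t) \<longrightarrow> Y o\<^sub>L B = B o\<^sub>L Y)"
    using small_quadratic_root[OF norm_K[of "2 * t"] q_less_1] unfolding \<rho>_def by metis
  from someI_ex[OF this, folded Y_def]
  show "norm (Y t) \<le> \<rho>" "Y t = (1/4) *\<^sub>R K (2 * t) + (Y t o\<^sub>L Y t)"
    "K (2 * t) o\<^sub>L B = B o\<^sub>L K (2 * t) \<Longrightarrow> Y t o\<^sub>L B = B o\<^sub>L Y t"
    by blast+
qed

lemma norm_Y_apply: "norm (Y t x) \<le> \<rho> * norm x"
  using norm_blinfun[of "Y t" x] Y(1)[of t] by (meson mult_right_mono norm_ge_zero order_trans)

lemma Y_quadratic: "Y t x = (1/4) *\<^sub>R K (2 * t) x + Y t (Y t x)"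
  by (subst Y(2)) (simp add: blinfun.add_left blinfun.scaleR_left)

lemma Y_K_commute: "Y t (K s x) = K s (Y t x)"
proof -
  have "K (2 * t) o\<^sub>L K s = K s o\<^sub>L K (2 * t)"
    by (intro blinfun_eqI) (simp add: K_commute)
  from Y(3)[OF this] show ?thesis by (metis blinfun_apply_blinfun_compose)
qed

lemma Y_commute: "Y t (Y s x) = Y s (Y t x)"
proof -
  have "K (2 * t) o\<^sub>L Y s = Y s o\<^sub>L K (2 * t)"
    by (intro blinfun_eqI) (simp add: Y_K_commute)
  from Y(3)[OF this] show ?thesis by (metis blinfun_apply_blinfun_compose)
qed

text \<open>
  By the quadratic equation \<open>Y(t) (I - Y(t)) = K(2t) / 4\<close>, and \<open>I - Y(t)\<close> shrinks no vector by
  more than the factor \<open>1/2\<close>.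
\<close>

lemma norm_Y_le_half: "norm (Y t x) \<le> norm (K (2 * t) x) / 2"
proof -
  have "norm (Y t x) \<le> norm ((1/4) *\<^sub>R K (2 * t) x) + norm (Y t (Y t x))"
    by (subst Y_quadratic) (rule norm_triangle_ineq)
  also have "norm (Y t (Y t x)) \<le> \<rho> * norm (Y t x)" by (rule norm_Y_apply)
  also have "\<dots> \<le> (1/2) * norm (Y t x)"
    using \<rho>_less by (intro mult_right_mono) auto
  finally show ?thesis by simp
qed

lemma Y_tendsto_0: "((\<lambda>h. Y h x) \<longlongrightarrow> 0) (at 0)"
proof (rule Lim_null_comparison)
  show "\<forall>\<^sub>F h in at 0. norm (Y h x) \<le> norm (K (2 * h) x) / 2"
    by (intro always_eventually allI norm_Y_le_half)
  have "filterlim (\<lambda>h::real. 2 * h) (at 0) (at 0)"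
    by (auto simp: filterlim_at eventually_at_filter intro!: tendsto_eq_intros)
  from filterlim_compose[OF K_tendsto_0 this]
  show "((\<lambda>h. norm (K (2 * h) x) / 2) \<longlongrightarrow> 0) (at 0)"
    by (intro tendsto_divide_zero tendsto_norm_zero)
qed

text \<open>
  Subtracting the quadratic equations of the commuting operators \<open>Y(t)\<close> and \<open>Y(s)\<close> gives
  \<open>(Y(t) - Y(s)) (I - Y(t) - Y(s)) = (K(2t) - K(2s)) / 4\<close>, where the second factor is bounded
  below by \<open>1 - 2 \<rho>\<close>.
\<close>

lemma Y_Lipschitz: "(1 - 2 * \<rho>) * norm (Y t x - Y s x) \<le> norm (K (2 * t) x - K (2 * s) x) / 4"
proof -
  define d where "d = Y t x - Y s x"
  have "d = (1/4) *\<^sub>R (K (2 * t) x - K (2 * s) x) + (Y t d + Y s d)"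
    using Y_quadratic[of t x] Y_quadratic[of s x] Y_commute[of t s x]
    by (simp add: d_def blinfun.diff_right algebra_simps)
  then have "norm d \<le> norm ((1/4) *\<^sub>R (K (2 * t) x - K (2 * s) x)) + (norm (Y t d) + norm (Y s d))"
    by (metis norm_triangle_mono norm_triangle_ineq order_refl)
  also have "norm (Y t d) + norm (Y s d) \<le> \<rho> * norm d + \<rho> * norm d"
    by (intro add_mono norm_Y_apply)
  finally show ?thesis unfolding norm_scaleR d_def[symmetric] by (simp add: algebra_simps)
qed

section \<open>Vectors on the principal branch\<close>

definition principal :: "real \<Rightarrow> 'a \<Rightarrow> bool" where
  "principal t x \<longleftrightarrow> K t x = Y t x"

lemma principal_K: "principal t x \<Longrightarrow> principal t (K s x)"
  by (metis principal_def K_commute Y_K_commute)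

lemma principal_Y: "principal t x \<Longrightarrow> principal t (Y s x)"
  by (metis principal_def Y_commute Y_K_commute)

lemma principal_diff: "principal t x \<Longrightarrow> principal t y \<Longrightarrow> principal t (x - y)"
  by (simp add: principal_def blinfun.diff_right)

lemmas principal_intros = principal_K principal_Y principal_diff

lemma K_Y_solve_same_quadratic: "K t x - K t (K t x) = Y t x - Y t (Y t x)"
proof -
  have "(1/4) *\<^sub>R K (2 * t) x = K t x - K t (K t x)"
    by (simp add: K_double)
  moreover have "(1/4) *\<^sub>R K (2 * t) x = Y t x - Y t (Y t x)"
    using Y_quadratic[of t x] by (simp only: eq_diff_eq)
  ultimately show ?thesis by simp
qed

text \<open>
  The factorization \<open>(K - Y) (I - K - Y) = 0\<close>, read in both orders: the range of \<open>K - Y\<close> lies on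
  the branch \<open>K = I - Y\<close>, and the range of \<open>I - K - Y\<close> on the principal branch
  (next lemma). Up to an invertible factor these two operators are the spectral projections onto
  the branches.
\<close>

lemma other_branch:
  assumes "w = K t x - Y t x"
  shows "w = K t w + Y t w"
  using K_Y_solve_same_quadratic[of t x] Y_K_commute[of t t x] unfolding assms
  by (simp add: blinfun.diff_right algebra_simps)

lemma principal_factor: "principal t (x - K t x - Y t x)"
  using K_Y_solve_same_quadratic[of t x] Y_K_commute[of t t x]
  by (simp add: principal_def blinfun.diff_right blinfun.add_right algebra_simps)

lemma norm_K_le_half: "principal t x \<Longrightarrow> norm (K t x) \<le> norm (K (2 * t) x) / 2"
  using norm_Y_le_half[of t x] by (simp add: principal_def)

lemma norm_K_le_power:
  assumes "\<And>i. 1 \<le> i \<Longrightarrow> i \<le> n \<Longrightarrow> principal (t / 2 ^ i) x"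
  shows "norm (K (t / 2 ^ n) x) \<le> (1/2) ^ n * q * norm x"
  using assms
proof (induction n)
  case 0
  then show ?case using norm_K_apply[of t x] by simp
next
  case (Suc n)
  have "norm (K (t / 2 ^ Suc n) x) \<le> norm (K (2 * (t / 2 ^ Suc n)) x) / 2"
    using Suc.prems[of "Suc n"] by (intro norm_K_le_half) auto
  with Suc show ?case by (simp add: mult.assoc)
qed

text \<open>
  The obstruction \<open>w = K(s) x - Y(s) x\<close> satisfies \<open>w = K(s) w + Y(s) w\<close>. It inherits
  principality at the larger times from \<open>x\<close>, which makes \<open>Y(s) w\<close> negligible and leaves
  \<open>\<parallel>w\<parallel> \<le> (q + small) \<parallel>w\<parallel>\<close>.
\<close>

lemma principal_descend:
  assumes n: "q + (1/2) ^ n * q < 1"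
    and pr: "\<And>i. 1 \<le> i \<Longrightarrow> i \<le> n \<Longrightarrow> principal (t / 2 ^ i) x"
  shows "principal (t / 2 ^ Suc n) x"
proof -
  define s where "s = t / 2 ^ Suc n"
  define w where "w = K s x - Y s x"
  have w: "norm (K (2 * s) w) \<le> (1/2) ^ n * q * norm w"
    using norm_K_le_power[of n t w] pr by (simp add: s_def w_def principal_intros)
  have "norm w \<le> norm (K s w) + norm (Y s w)"
    using other_branch[OF w_def] by (metis norm_triangle_ineq)
  also have "norm (K s w) \<le> q * norm w" by (rule norm_K_apply)
  also have "norm (Y s w) \<le> norm (K (2 * s) w)"
    using norm_Y_le_half[of s w] norm_ge_zero[of "K (2 * s) w"] by linarith
  also note w
  finally have "(1 - (q + (1/2) ^ n * q)) * norm w \<le> 0" by (simp add: algebra_simps)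
  then have "w = 0" using n by (simp add: mult_le_0_iff)
  then show ?thesis by (simp add: principal_def w_def s_def)
qed

lemma principal_all_smaller:
  assumes n: "q + (1/2) ^ n * q < 1"
    and pr: "\<And>i. 1 \<le> i \<Longrightarrow> i \<le> n \<Longrightarrow> principal (t / 2 ^ i) x"
  shows "1 \<le> k \<Longrightarrow> principal (t / 2 ^ k) x"
proof (induction k rule: less_induct)
  case (less k)
  show ?case
  proof (cases "k \<le> n")
    case True
    then show ?thesis using pr less.prems by simp
  next
    case False
    then obtain j where k: "k = Suc n + j" using less_iff_Suc_add by (metis add.commute add_Suc not_le)
    have "principal ((t / 2 ^ j) / 2 ^ Suc n) x"
    proof (rule principal_descend[OF n])
      fix i assume "1 \<le> i" "i \<le> n"
      then show "principal (t / 2 ^ j / 2 ^ i) x"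
        using less.IH[of "j + i"] k by (simp add: power_add)
    qed
    then show ?thesis by (simp add: k power_add mult.commute mult.left_commute)
  qed
qed

section \<open>Density of eventually principal vectors\<close>

text \<open>
  Every factor \<open>I - K(t/2\<^sup>i) - Y(t/2\<^sup>i)\<close> kills the part of a vector on the other branch at
  \<open>t/2\<^sup>i\<close>, and later factors preserve what earlier ones achieved since all operators commute.
\<close>

fun F :: "real \<Rightarrow> nat \<Rightarrow> 'a \<Rightarrow> 'a" where
  "F t 0 x = x"
| "F t (Suc n) x = (let y = F t n x in y - K (t / 2 ^ Suc n) y - Y (t / 2 ^ Suc n) y)"

lemma principal_F: "1 \<le> i \<Longrightarrow> i \<le> n \<Longrightarrow> principal (t / 2 ^ i) (F t n x)"
proof (induction n)
  case (Suc n)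
  then show ?case
    by (cases "i = Suc n")
       (auto simp: Let_def principal_factor simp del: power_Suc intro!: principal_intros)
qed simp

text \<open>
  Each factor tends strongly to the identity as its time tends to \<open>0\<close>, and the factors are
  uniformly bounded, so a product of a fixed number of them does the same.
\<close>

lemma F_tendsto:
  assumes t: "filterlim t (at 0) sequentially"
  shows "(\<lambda>j. F (t j) n x) \<longlonglongrightarrow> x"
proof (induction n)
  case (Suc n)
  have t': "filterlim (\<lambda>j. t j / 2 ^ Suc n) (at 0) sequentially"
    using t by (auto simp: filterlim_at intro!: tendsto_eq_intros)
  have vanish: "(\<lambda>j. B j (F (t j) n x)) \<longlonglongrightarrow> 0"
    if B: "(\<lambda>j. B j x) \<longlonglongrightarrow> 0" and bound: "\<And>j z. norm (B j z) \<le> 1 * norm z"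
    for B :: "nat \<Rightarrow> 'a \<Rightarrow>\<^sub>L 'a"
  proof -
    have "(\<lambda>j. B j (F (t j) n x - x)) \<longlonglongrightarrow> 0"
    proof (rule Lim_null_comparison)
      show "\<forall>\<^sub>F j in sequentially. norm (B j (F (t j) n x - x)) \<le> norm (F (t j) n x - x)"
        using bound by simp
      show "(\<lambda>j. norm (F (t j) n x - x)) \<longlonglongrightarrow> 0"
        using Suc.IH by (simp add: LIM_zero tendsto_norm_zero)
    qed
    from tendsto_add[OF this B] show ?thesis by (simp add: blinfun.diff_right)
  qed
  have "(\<lambda>j. K (t j / 2 ^ Suc n) (F (t j) n x)) \<longlonglongrightarrow> 0"
  proof (rule vanish)
    show "norm (K (t j / 2 ^ Suc n) z) \<le> 1 * norm z" for j z
      by (intro order_trans[OF norm_K_apply] mult_right_mono less_imp_le q_less_1 norm_ge_zero)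
  qed (rule filterlim_compose[OF K_tendsto_0 t'])
  moreover have "(\<lambda>j. Y (t j / 2 ^ Suc n) (F (t j) n x)) \<longlonglongrightarrow> 0"
  proof (rule vanish)
    show "norm (Y (t j / 2 ^ Suc n) z) \<le> 1 * norm z" for j z
      using \<rho>_less by (intro order_trans[OF norm_Y_apply] mult_right_mono) auto
  qed (rule filterlim_compose[OF Y_tendsto_0 t'])
  ultimately have "(\<lambda>j. F (t j) n x - K (t j / 2 ^ Suc n) (F (t j) n x)
      - Y (t j / 2 ^ Suc n) (F (t j) n x)) \<longlonglongrightarrow> x - 0 - 0"
    using Suc.IH by (intro tendsto_diff)
  then show ?case by (simp add: Let_def)
qed simp

section \<open>Propagation along small steps\<close>

lemma norm_C_apply: "norm (C t x) \<le> 3 * norm x"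
proof -
  have "norm (C t x) \<le> norm x + norm (2 *\<^sub>R K t x)"
    unfolding C_apply by (rule norm_triangle_ineq4)
  also have "norm (2 *\<^sub>R K t x) \<le> 2 * (q * norm x)"
    using norm_K_apply[of t x] by simp
  also have "\<dots> \<le> 2 * (1 * norm x)"
    using q_less_1 by (intro mult_left_mono mult_right_mono) auto
  finally show ?thesis by simp
qed

text \<open>
  The cosine equation gives \<open>C(t + s) - 2 C(t) + C(t - s) = 2 C(t) (C(s) - I)\<close>, so the second
  differences of \<open>C\<close> with step \<open>s\<close> are small once \<open>C(s) - I\<close> is.
\<close>

lemma first_difference_C:
  assumes small: "norm (C s x - x) \<le> \<epsilon> * norm x"
  shows "real N * norm (C (real (m + 1) * s) x - C (real m * s) x) \<le> (6 + 6 * real N ^ 2 * \<epsilon>) * norm x"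
proof -
  define a where "a m = C (real m * s) x" for m
  have "norm (a (m + 2) - 2 *\<^sub>R a (m + 1) + a m) \<le> 6 * \<epsilon> * norm x" for m
  proof -
    have "a (m + 2) - 2 *\<^sub>R a (m + 1) + a m = 2 *\<^sub>R C (real (m + 1) * s) (C s x - x)"
      using C_mult[of "real (m + 1) * s" s x] by (simp add: a_def blinfun.diff_right algebra_simps)
    then have "norm (a (m + 2) - 2 *\<^sub>R a (m + 1) + a m) \<le> 2 * (3 * norm (C s x - x))"
      using norm_C_apply[of "real (m + 1) * s" "C s x - x"] by simp
    then show ?thesis using small by simp
  qed
  moreover have "norm (a m) \<le> 3 * norm x" for m
    by (simp add: a_def norm_C_apply)
  ultimately show ?thesis
    using first_difference_from_second[of a "6 * \<epsilon> * norm x" "3 * norm x" N m]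
    by (simp add: a_def algebra_simps)
qed

text \<open>
  Suppose every vector of \<open>V\<close> is principal at \<open>t\<close>, and let \<open>w\<close> be an obstruction at the next
  time \<open>t'\<close>. Then \<open>w = K(t') w + Y(t') w\<close>, whereas \<open>K(t) w + Y(t) w = 2 Y(t) w\<close> has norm at most
  \<open>2 \<rho> \<parallel>w\<parallel>\<close>. A step shorter than the gap \<open>1 - 2 \<rho>\<close> cannot reconcile the two. The set \<open>V\<close> must be
  fixed in advance since the induction hypothesis is applied to \<open>w\<close>.
\<close>

lemma principal_if_small_steps:
  assumes inv: "\<And>x t. x \<in> V \<Longrightarrow> K t x - Y t x \<in> V"
    and \<epsilon>: "\<epsilon> < 1 - 2 * \<rho>"
    and step: "\<And>x m. x \<in> V \<Longrightarrow> norm (K (real (m + 1) * s) x - K (real m * s) x)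
                 + norm (Y (real (m + 1) * s) x - Y (real m * s) x) \<le> \<epsilon> * norm x"
  shows "x \<in> V \<Longrightarrow> principal (real m * s) x"
proof (induction m arbitrary: x)
  case 0
  then show ?case using norm_Y_le_half[of 0 x] by (simp add: principal_def K_0)
next
  case (Suc m)
  define t where "t = real m * s"
  define t' where "t' = real (m + 1) * s"
  define w where "w = K t' x - Y t' x"
  have w: "w \<in> V" unfolding w_def using Suc.prems by (rule inv)
  have "K t w = Y t w"
    using Suc.IH[OF w] by (simp add: principal_def t_def)
  then have "w = (K t' w - K t w) + (Y t' w - Y t w) + 2 *\<^sub>R Y t w"
    using other_branch[OF w_def] by (simp add: scaleR_2)
  then have "norm w \<le> norm (K t' w - K t w) + norm (Y t' w - Y t w) + norm (2 *\<^sub>R Y t w)"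
    by (metis norm_triangle_ineq norm_triangle_mono order_refl)
  also have "\<dots> \<le> \<epsilon> * norm w + 2 * (\<rho> * norm w)"
    using step[OF w, of m] norm_Y_apply[of t w] by (simp add: t_def t'_def)
  finally have "(1 - 2 * \<rho> - \<epsilon>) * norm w \<le> 0" by (simp add: algebra_simps)
  then have "w = 0" using \<epsilon> by (simp add: mult_le_0_iff)
  then show ?case by (simp add: principal_def w_def t'_def)
qed

text \<open>
  The vectors principal at all \<open>t / 2\<^sup>k\<close> form an invariant set \<open>V\<close> on which \<open>K(t / 2\<^sup>k)\<close> tends to
  \<open>0\<close> uniformly. With a sufficiently fine step \<open>s = t / 2\<^sup>k\<close> one can then walk from \<open>0\<close> to
  \<open>2\<^sup>j t = 2\<^bsup>j+k\<^esup> s\<close>.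
\<close>

lemma principal_at_multiple:
  assumes pr: "\<And>k. 1 \<le> k \<Longrightarrow> principal (t / 2 ^ k) x"
  shows "principal (2 ^ j * t) x"
proof -
  define V where "V = {x. \<forall>k\<ge>1. principal (t / 2 ^ k) x}"
  define g where "g = 1 - 2 * \<rho>"
  have g: "0 < g" using \<rho>_less by (simp add: g_def)
  have V: "K t x - Y t x \<in> V" if "x \<in> V" for t x
    using that by (auto simp: V_def intro!: principal_intros)
  (* The steps of C are at most \<delta>, those of K at most \<delta>/2, and those of Y at most \<delta>/(4 g);
     their combined size \<delta> * b for K and Y has to stay below the gap g. With
     C(s) - I of norm at most 1/N^2 on V, the difference inequality bounds the steps of C
     by (6 + 6)/N, whence the 12. *)
  define b where "b = 1/2 + 1 / (4 * g)"
  have b: "0 < b" using g by (simp add: b_def add_pos_pos)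
  obtain N :: nat where N: "0 < N" "12 * b < real N * g"
  proof -
    obtain N where N: "12 * b / g < real N" using reals_Archimedean2 by blast
    then have "0 < real N" using b g by (smt (verit) divide_pos_pos mult_pos_pos)
    with N show ?thesis using that[of N] g by (simp add: pos_divide_less_eq)
  qed
  define \<delta> where "\<delta> = 12 / real N"
  have \<delta>: "\<delta> * b < g"
    using N by (simp add: \<delta>_def pos_divide_less_eq mult.commute)
  obtain k where k: "(1/2) ^ k < 1 / (2 * real N ^ 2)"
    using real_arch_pow_inv[of "1 / (2 * real N ^ 2)" "1/2"] N(1) by auto
  define s where "s = t / 2 ^ k"
  have C_step: "norm (C (real (m + 1) * s) y - C (real m * s) y) \<le> \<delta> * norm y" if y: "y \<in> V" for y m
  proof -
    have "norm (K s y) \<le> (1/2) ^ k * q * norm y"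
      using y unfolding s_def V_def by (intro norm_K_le_power) auto
    also have "\<dots> \<le> 1 / (2 * real N ^ 2) * 1 * norm y"
      using k q_less_1 q_nonneg by (intro mult_right_mono mult_mono) auto
    finally have "norm (C s y - y) \<le> (1 / real N ^ 2) * norm y"
      by (simp add: C_apply)
    from first_difference_C[OF this, of N m] N(1) show ?thesis
      by (simp add: \<delta>_def field_simps)
  qed
  have K_step: "norm (K (real (m + 1) * s) y - K (real m * s) y) \<le> \<delta> * norm y / 2" if y: "y \<in> V" for y m
  proof -
    have "K (real (m + 1) * s) y - K (real m * s) y
        = - ((1/2) *\<^sub>R (C (real (m + 1) * s) y - C (real m * s) y))"
      by (simp add: K_apply algebra_simps)
    then show ?thesis using C_step[OF y, of m] by (simp only: norm_minus_cancel norm_scaleR)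
  qed
  have Y_step: "norm (Y (real (m + 1) * s) y - Y (real m * s) y) \<le> \<delta> * norm y / (4 * g)" if y: "y \<in> V" for y m
  proof -
    have "g * norm (Y (real (m + 1) * s) y - Y (real m * s) y)
        \<le> norm (K (2 * (real (m + 1) * s)) y - K (2 * (real m * s)) y) / 4"
      unfolding g_def by (rule Y_Lipschitz)
    \<comment> \<open>The estimate for \<open>Y\<close> involves doubled times, hence two steps of \<open>K\<close>.\<close>
    also have "K (2 * (real (m + 1) * s)) y - K (2 * (real m * s)) y
        = (K (real (2 * m + 1 + 1) * s) y - K (real (2 * m + 1) * s) y)
          + (K (real (2 * m + 1) * s) y - K (real (2 * m) * s) y)"
      by (simp add: algebra_simps)
    also have "norm \<dots> \<le> \<delta> * norm y / 2 + \<delta> * norm y / 2"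
      by (rule norm_triangle_mono[OF K_step[OF y] K_step[OF y]])
    finally show ?thesis using g by (simp add: field_simps)
  qed
  have step: "norm (K (real (m + 1) * s) y - K (real m * s) y)
      + norm (Y (real (m + 1) * s) y - Y (real m * s) y) \<le> (\<delta> * b) * norm y" if "y \<in> V" for y m
    using add_mono[OF K_step[OF that, of m] Y_step[OF that, of m]] g
    by (simp add: b_def field_simps)
  have "principal (real (2 ^ (j + k)) * s) x"
  proof (rule principal_if_small_steps[where V = V])
    show "x \<in> V" using pr by (simp add: V_def)
    show "\<delta> * b < 1 - 2 * \<rho>" using \<delta> by (simp add: g_def)
  qed (use V step in auto)
  then show ?thesis by (simp add: s_def power_add)
qed

text \<open>
  The vectors \<open>F (t / 2\<^sup>j) n x\<close> are principal at \<open>t / 2\<^bsup>j+i\<^esup>\<close> for \<open>1 \<le> i \<le> n\<close>, hence at all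
  smaller dyadic fractions, hence at \<open>t\<close>. They converge to \<open>x\<close> as \<open>j\<close> grows.
\<close>

lemma principal: "principal t x"
proof -
  obtain n where n: "(1/2) ^ n < 1 - q"
    using real_arch_pow_inv[of "1 - q" "1/2"] q_less_1 by auto
  have "(1/2) ^ n * q \<le> (1/2) ^ n * 1"
    using q_less_1 by (intro mult_left_mono) auto
  with n have n: "q + (1/2) ^ n * q < 1" by linarith
  show ?thesis
  proof (cases "t = 0")
    case True
    then show ?thesis using norm_Y_le_half[of 0 x] by (simp add: principal_def K_0)
  next
    case False
    define F' where "F' j = F (t / 2 ^ j) n x" for j
    have "principal t (F' j)" for j
    proof -
      have "principal (t / 2 ^ j / 2 ^ k) (F' j)" if "1 \<le> k" for k
        using principal_all_smaller[OF n principal_F that] unfolding F'_def .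
      from principal_at_multiple[OF this, of j] show ?thesis by simp
    qed
    moreover have "filterlim (\<lambda>j. t / 2 ^ j) (at 0) sequentially"
    proof -
      have "(\<lambda>j. t * (1/2) ^ j) \<longlonglongrightarrow> t * 0"
        by (intro tendsto_mult tendsto_const LIMSEQ_power_zero) auto
      then show ?thesis using False by (auto simp: filterlim_at power_one_over field_simps)
    qed
    then have lim: "F' \<longlonglongrightarrow> x"
      unfolding F'_def by (rule F_tendsto)
    have "(\<lambda>j. K t (F' j)) \<longlonglongrightarrow> K t x" "(\<lambda>j. Y t (F' j)) \<longlonglongrightarrow> Y t x"
      by (intro blinfun.tendsto tendsto_const lim)+
    ultimately show ?thesis
      unfolding principal_def by (metis (no_types, lifting) LIMSEQ_unique ext)
  qed
qed

section \<open>Triviality\<close>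

lemma C_eq_id: "C t = id_blinfun"
proof (rule blinfun_eqI)
  fix x
  have "norm (K t x) \<le> (1/2) ^ n * q * norm x" for n
    using norm_K_le_power[of n "2 ^ n * t" x] principal by simp
  moreover have "(\<lambda>n. (1/2) ^ n * q * norm x) \<longlonglongrightarrow> 0 * q * norm x"
    by (intro tendsto_mult tendsto_const LIMSEQ_power_zero) auto
  ultimately have "norm (K t x) \<le> 0 * q * norm x"
    by (intro LIMSEQ_le_const) auto
  then show "C t x = id_blinfun x" by (simp add: C_apply)
qed

end

lemma cosine_family_even:
  assumes "cosine_family C"
  shows "C (- t) = C t"
proof -
  have "C 0 = id_blinfun" "2 *\<^sub>R (C 0 o\<^sub>L C t) = C (0 + t) + C (0 - t)"
    using assms unfolding cosine_family_def by blast+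
  moreover have "id_blinfun o\<^sub>L C t = C t"
    by (rule blinfun_eqI) simp
  ultimately show ?thesis by (simp add: scaleR_2)
qed

lemma cosine_family_near_identity_trivial:
  fixes C :: "real \<Rightarrow> 'a::banach \<Rightarrow>\<^sub>L 'a"
  assumes "cosine_family C" "strongly_continuous C" "sup_dist_id C = ereal r" "r < 2"
  shows "C t = id_blinfun"
proof -
  have "norm (C s - id_blinfun) \<le> r" for s
    using norm_le_if_sup_dist_id_le[of C r "\<bar>s\<bar>"] cosine_family_even[OF assms(1), of s] assms(3)
    by (cases "0 \<le> s") auto
  then interpret cosine_near_identity C "r / 2"
    using assms by unfold_locales auto
  show ?thesis by (rule C_eq_id)
qed

theorem theorem3p1:
  "(\<forall>T :: real \<Rightarrow> 'a::banach \<Rightarrow>\<^sub>L 'a.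
      operator_semigroup T \<and> sup_dist_id T < 1 \<longrightarrow> (\<forall>t\<ge>0. T t = id_blinfun)) \<and>
   (\<forall>(C :: real \<Rightarrow> 'a \<Rightarrow>\<^sub>L 'a) (r :: real).
      cosine_family C \<and> strongly_continuous C \<and> sup_dist_id C = ereal r \<and> r < 2
        \<longrightarrow> (\<forall>t. C t = id_blinfun))"
  using semigroup_near_identity_trivial cosine_family_near_identity_trivial by blast

end
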